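(* In the sequent calculus over $\mathfrak{C}$ described in the context, for objects $A,B$ of $\mathfrak{C}$, let $x=y$ denote the formula $\neg(\nabla_A\otimes\mathrm{id}_B)^*\bot$ of type $A\otimes A\otimes B$ (in the context $x:A,\,y:A,\,z:B$). Then the following two-way rule for $=$ is admissible, for all contexts $\Gamma,\Gamma'$ of type $A\otimes A\otimes B$: $$x:A,\,y:A,\,z:B\mid\Gamma,\ x=y\vdash\Gamma'\quad\text{is derivable if and only if}\quad x:A,\,z:B\mid\Gamma[y/x]\vdash\Gamma'[y/x]\ \text{is derivable},$$ where the substitution $[y/x]$ identifying $x$ and $y$ is $(\Delta_A\otimes\mathrm{id}_B)^*$.
   Context: Composition: $gf$ means first $f$, then $g$. A partial cartesian category is a locally posetal symmetric monoidal bicategory $\mathfrak{C}$ (hom-posets ordered by $\sqsubseteq$) such that every object $A$ has a unique cocommutative comonoid structure $\Delta_A:A\to A\otimes A$, $!_A:A\to I$, $\Delta$ strictly natural, $!$ lax natural ($!_Bf\sqsubseteq\,!_A$), and $\Delta_A$ has a right adjoint $\nabla_A:A\otimes A\to A$ with $\Delta_A\nabla_A=(\nabla_A\otimes\mathrm{id})(\mathrm{id}\otimes\Delta_A)$ and $\nabla_B(f\otimes g)\Delta_A\sqsubseteq f$. For $f:A\to B$, $\overline f:A\to A$ is $(\mathrm{id}\otimes(!_Bf))\Delta_A$ (using $A\otimes I\cong A$); $f$ is total if $\overline f=\mathrm{id}$. Functionally complete: every $d\sqsubseteq\mathrm{id}_A$ with $d^2=d$ is $ij$ with $i\dashv j$.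 Weak comma objects: for $f:A\to B$, $g:C\to B$ there are an object $f/g$ and total $\hat g:f/g\to A$, $\hat f:f/g\to C$ with $f\hat g\sqsubseteq g\hat f$ such that for $\phi:S\to A$, $\psi:S\to C$ with $f\phi\sqsubseteq g\psi$ there is a unique $\langle\phi,\psi\rangle:S\to f/g$ with $\hat g\langle\phi,\psi\rangle=\phi\overline\psi$, $\hat f\langle\phi,\psi\rangle=\psi\overline\phi$. Fix a functionally complete partial cartesian category $\mathfrak{C}$ with weak comma objects. A variable context $x:A,y:A,z:B$ stands for the type $A\otimes A\otimes B$, and $x:A,z:B$ for $A\otimes B$. Formulae (typed by objects of $\mathfrak{C}$): atomic formulae, each with a type; $\top:A$, $\bot:A$; if $P,Q:A$ then $\neg P,\ P\wedge Q,\ P\vee Q:A$; if $f:A\to B$ and $Q:B$ then $f^*Q:A$; if $f:A\to B$ and $P:A$ then $\coprod_fP:B$. A sequent $A\mid\Gamma\vdash\Delta$ (type often omitted) consists of finite multisets $\Gamma,\Delta$ of formulae of type $A$. For $\Gamma$ on the left, $f^*\Gamma=\{f^*P:P\in\Gamma\}$; for $\Delta$ on the right, $f^*\Delta=\{f^*Q:Q\in\Delta\}$ if $\Delta\ne\emptyset$, and $f^*\Delta=\{f^*\bot\}$ if $\Delta=\emptyset$. Rules (premises $\Rightarrow$ conclusion; $f,g,\dots$ range over 1-cells of suitable type): Ax: $\Gamma,P\vdash\Delta,P$. Weakening: $\Gamma\vdash\Delta\Rightarrow\Gamma,P\vdash\Delta$; $\Gamma\vdash\Delta\Rightarrow\Gamma\vdash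 Q,\Delta$. Contraction: $\Gamma,P,P\vdash\Delta\Rightarrow\Gamma,P\vdash\Delta$; $\Gamma\vdash Q,Q,\Delta\Rightarrow\Gamma\vdash Q,\Delta$. $\bot$L: $\Gamma,\bot\vdash\Delta$. $\top$R: $\Gamma\vdash\top,\Delta$. $f^*\bot$L: $f^*\Gamma,\bot\vdash f^*\Delta$. $f^*\top$R: $\Gamma\vdash f^*\top,\Delta$. $\vee$L: $\Gamma,P_1\vdash\Delta$ and $\Gamma,P_2\vdash\Delta\Rightarrow\Gamma,P_1\vee P_2\vdash\Delta$. $\vee$R: $\Gamma\vdash\Delta,Q_1,Q_2\Rightarrow\Gamma\vdash\Delta,Q_1\vee Q_2$. $f^*\vee$L: $\Gamma,f^*P_1\vdash\Delta$ and $\Gamma,f^*P_2\vdash\Delta\Rightarrow\Gamma,f^*(P_1\vee P_2)\vdash\Delta$. $f^*\vee$R: $\Gamma\vdash\Delta,f^*Q_1,f^*Q_2\Rightarrow\Gamma\vdash\Delta,f^*(Q_1\vee Q_2)$. $\wedge$L: $\Gamma,P_1,P_2\vdash\Delta\Rightarrow\Gamma,P_1\wedge P_2\vdash\Delta$. $\wedge$R: $\Gamma\vdash Q_1,\Delta$ and $\Gamma\vdash Q_2,\Delta\Rightarrow\Gamma\vdash Q_1\wedge Q_2,\Delta$. $f^*\wedge$L: $\Gamma,f^*P_1,f^*P_2\vdash\Delta\Rightarrow\Gamma,f^*(P_1\wedge P_2)\vdash\Delta$. $f^*\wedge$R: $\Gamma\vdash f^*Q_1,\Delta$ and $\Gamma\vdash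 f^*Q_2,\Delta\Rightarrow\Gamma\vdash f^*(Q_1\wedge Q_2),\Delta$. $\neg$L: $\Gamma\vdash Q,\Delta\Rightarrow\Gamma,\neg Q\vdash\Delta$. $\neg$R: $\Gamma,Q\vdash\Delta\Rightarrow\Gamma\vdash\neg Q,\Delta$. $f^*\neg$L: $\Gamma,f^*\bot\vdash\Delta$ and $\Gamma\vdash f^*Q,\Delta\Rightarrow\Gamma,f^*(\neg Q)\vdash\Delta$. $f^*\neg$R: $\Gamma,f^*Q\vdash f^*\bot,\Delta\Rightarrow\Gamma\vdash f^*(\neg Q),\Delta$. Cut: $\Gamma\vdash f_1^*P,\Delta$ and $\Gamma',f_2^*P\vdash\Delta'$, with $f_2\sqsubseteq f_1$, $\Rightarrow\Gamma,\Gamma'\vdash\Delta,\Delta'$. $f^*$: $\Gamma\vdash\Delta\Rightarrow f^*\Gamma\vdash f^*\Delta$. $\coprod$L: for $f:A\to B$, $g:C\to B$, with $\hat g:f/g\to A$, $\hat f:f/g\to C$: $\hat g^*\Gamma,\hat f^*P\vdash\hat g^*\Delta\Rightarrow\Gamma,f^*(\coprod_gP)\vdash\Delta$. $\coprod$R: $\Gamma\vdash\tau^*Q,\Delta$, with $f\sqsubseteq g\tau$, $\Rightarrow\Gamma\vdash f^*\coprod_gQ,\Delta$. For $f\sqsubseteq g$: $\sqsubseteq$L: $\Gamma,f^*P\vdash\Delta\Rightarrow\Gamma,g^*P\vdash\Delta$; $\sqsubseteq$R: $\Gamma\vdash g^*Q,\Delta\Rightarrow\Gamma\vdash f^*Q,\Delta$;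 $\sqsubseteq$LR: $\Gamma,g^*\Gamma'\vdash g^*\Delta',\Delta\Rightarrow\Gamma,f^*\Gamma'\vdash f^*\Delta',\Delta$. $\circ$, $\circ^{-1}$: on either side, $f^*g^*P$ may be replaced by $(gf)^*P$, and conversely. $\mathrm{Id}$, $\mathrm{Id}^{-1}$: on either side, $P$ may be replaced by $\mathrm{id}^*P$, and conversely. *)

theory Defs
  imports Main "HOL-Library.Multiset"
begin

section \<open>Locally posetal symmetric monoidal bicategories\<close>

text \<open>
  In a locally posetal bicategory invertible 2-cells are equalities. Hence composition of 1-cells is
  strictly associative and unital, pseudonatural transformations are strictly natural, equivalences
  are isomorphisms, and the coherence 2-cells of a symmetric monoidal bicategory amount to the
  usual equations between 1-cells. Composition is written in applicative order: \<open>g \<cdot> f\<close> is first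
  \<open>f\<close>, then \<open>g\<close>. The tensor is \<open>\<boxtimes>\<close> on objects and \<open>\<otimes>\<close> on 1-cells.
\<close>

record ('o, 'a) sm_bicat =
  Obj :: "'o set"
  Arr :: "'a set"
  Dom :: "'a \<Rightarrow> 'o"
  Cod :: "'a \<Rightarrow> 'o"
  Ident :: "'o \<Rightarrow> 'a"
  Comp :: "'a \<Rightarrow> 'a \<Rightarrow> 'a" (infixl \<open>\<cdot>\<index>\<close> 70)
  Le :: "'a \<Rightarrow> 'a \<Rightarrow> bool" (infix \<open>\<sqsubseteq>\<index>\<close> 50)
  TensorO :: "'o \<Rightarrow> 'o \<Rightarrow> 'o" (infixl \<open>\<boxtimes>\<index>\<close> 75)
  TensorA :: "'a \<Rightarrow> 'a \<Rightarrow> 'a" (infixl \<open>\<otimes>\<index>\<close> 75)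
  Unit :: 'o
  Assoc :: "'o \<Rightarrow> 'o \<Rightarrow> 'o \<Rightarrow> 'a"
  LUnit :: "'o \<Rightarrow> 'a"
  RUnit :: "'o \<Rightarrow> 'a"
  Symm :: "'o \<Rightarrow> 'o \<Rightarrow> 'a"

definition hom :: "('o, 'a, 'm) sm_bicat_scheme \<Rightarrow> 'o \<Rightarrow> 'o \<Rightarrow> 'a set" where
  "hom C A B = {f \<in> Arr C. Dom C f = A \<and> Cod C f = B}"

definition inverse_cells :: "('o, 'a, 'm) sm_bicat_scheme \<Rightarrow> 'a \<Rightarrow> 'a \<Rightarrow> bool" where
  "inverse_cells C f g \<longleftrightarrow>
     f \<in> Arr C \<and> g \<in> hom C (Cod C f) (Dom C f) \<and>
     g \<cdot>\<^bsub>C\<^esub> f = Ident C (Dom C f) \<and> f \<cdot>\<^bsub>C\<^esub> g = Ident C (Cod C f)"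

definition iso_cell :: "('o, 'a, 'm) sm_bicat_scheme \<Rightarrow> 'a \<Rightarrow> bool" where
  "iso_cell C f \<longleftrightarrow> (\<exists>g. inverse_cells C f g)"

definition inv_cell :: "('o, 'a, 'm) sm_bicat_scheme \<Rightarrow> 'a \<Rightarrow> 'a" where
  "inv_cell C f = (THE g. inverse_cells C f g)"

locale posetal_bicategory =
  fixes C :: "('o, 'a, 'm) sm_bicat_scheme" (structure)
  assumes dom_obj: "f \<in> Arr C \<Longrightarrow> Dom C f \<in> Obj C"
    and cod_obj: "f \<in> Arr C \<Longrightarrow> Cod C f \<in> Obj C"
    and id_hom: "A \<in> Obj C \<Longrightarrow> Ident C A \<in> hom C A A"
    and comp_hom: "\<lbrakk>f \<in> hom C A B; g \<in> hom C B D\<rbrakk> \<Longrightarrow> g \<cdot> f \<in> hom C A D"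
    and id_left: "f \<in> hom C A B \<Longrightarrow> Ident C B \<cdot> f = f"
    and id_right: "f \<in> hom C A B \<Longrightarrow> f \<cdot> Ident C A = f"
    and comp_assoc: "\<lbrakk>f \<in> hom C A B; g \<in> hom C B D; h \<in> hom C D E\<rbrakk>
      \<Longrightarrow> h \<cdot> g \<cdot> f = h \<cdot> (g \<cdot> f)"
    and le_refl: "f \<in> hom C A B \<Longrightarrow> f \<sqsubseteq> f"
    and le_antisym: "\<lbrakk>f \<in> hom C A B; g \<in> hom C A B; f \<sqsubseteq> g; g \<sqsubseteq> f\<rbrakk> \<Longrightarrow> f = g"
    and le_trans: "\<lbrakk>f \<in> hom C A B; g \<in> hom C A B; h \<in> hom C A B; f \<sqsubseteq> g; g \<sqsubseteq> h\<rbrakk> \<Longrightarrow> f \<sqsubseteq> h"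
    and comp_mono: "\<lbrakk>f \<in> hom C A B; f' \<in> hom C A B; g \<in> hom C B D; g' \<in> hom C B D;
      f \<sqsubseteq> f'; g \<sqsubseteq> g'\<rbrakk> \<Longrightarrow> g \<cdot> f \<sqsubseteq> g' \<cdot> f'"

locale sm_posetal_bicategory = posetal_bicategory +
  assumes unit_obj: "Unit C \<in> Obj C"
    and tensor_obj: "\<lbrakk>A \<in> Obj C; B \<in> Obj C\<rbrakk> \<Longrightarrow> A \<boxtimes> B \<in> Obj C"
    and tensor_hom: "\<lbrakk>f \<in> hom C A B; g \<in> hom C A' B'\<rbrakk> \<Longrightarrow> f \<otimes> g \<in> hom C (A \<boxtimes> A') (B \<boxtimes> B')"
    and tensor_id: "\<lbrakk>A \<in> Obj C; B \<in> Obj C\<rbrakk> \<Longrightarrow> Ident C A \<otimes> Ident C B = Ident C (A \<boxtimes> B)"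
    and tensor_comp: "\<lbrakk>f \<in> hom C A B; g \<in> hom C B D; f' \<in> hom C A' B'; g' \<in> hom C B' D'\<rbrakk>
      \<Longrightarrow> (g \<cdot> f) \<otimes> (g' \<cdot> f') = (g \<otimes> g') \<cdot> (f \<otimes> f')"
    and tensor_mono: "\<lbrakk>f \<in> hom C A B; g \<in> hom C A B; f' \<in> hom C A' B'; g' \<in> hom C A' B';
      f \<sqsubseteq> g; f' \<sqsubseteq> g'\<rbrakk> \<Longrightarrow> f \<otimes> f' \<sqsubseteq> g \<otimes> g'"
    and assoc_hom: "\<lbrakk>A \<in> Obj C; B \<in> Obj C; D \<in> Obj C\<rbrakk>
      \<Longrightarrow> Assoc C A B D \<in> hom C ((A \<boxtimes> B) \<boxtimes> D) (A \<boxtimes> (B \<boxtimes> D))"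
    and assoc_iso: "\<lbrakk>A \<in> Obj C; B \<in> Obj C; D \<in> Obj C\<rbrakk> \<Longrightarrow> iso_cell C (Assoc C A B D)"
    and assoc_natural: "\<lbrakk>f \<in> hom C A A'; g \<in> hom C B B'; h \<in> hom C D D'\<rbrakk>
      \<Longrightarrow> Assoc C A' B' D' \<cdot> ((f \<otimes> g) \<otimes> h) = (f \<otimes> (g \<otimes> h)) \<cdot> Assoc C A B D"
    and lunit_hom: "A \<in> Obj C \<Longrightarrow> LUnit C A \<in> hom C (Unit C \<boxtimes> A) A"
    and lunit_iso: "A \<in> Obj C \<Longrightarrow> iso_cell C (LUnit C A)"
    and lunit_natural: "f \<in> hom C A B \<Longrightarrow> LUnit C B \<cdot> (Ident C (Unit C) \<otimes> f) = f \<cdot> LUnit C A"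
    and runit_hom: "A \<in> Obj C \<Longrightarrow> RUnit C A \<in> hom C (A \<boxtimes> Unit C) A"
    and runit_iso: "A \<in> Obj C \<Longrightarrow> iso_cell C (RUnit C A)"
    and runit_natural: "f \<in> hom C A B \<Longrightarrow> RUnit C B \<cdot> (f \<otimes> Ident C (Unit C)) = f \<cdot> RUnit C A"
    and symm_hom: "\<lbrakk>A \<in> Obj C; B \<in> Obj C\<rbrakk> \<Longrightarrow> Symm C A B \<in> hom C (A \<boxtimes> B) (B \<boxtimes> A)"
    and symm_natural: "\<lbrakk>f \<in> hom C A A'; g \<in> hom C B B'\<rbrakk>
      \<Longrightarrow> Symm C A' B' \<cdot> (f \<otimes> g) = (g \<otimes> f) \<cdot> Symm C A B"
    and symm_symm: "\<lbrakk>A \<in> Obj C; B \<in> Obj C\<rbrakk> \<Longrightarrow> Symm C B A \<cdot> Symm C A B = Ident C (A \<boxtimes> B)"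
    and pentagon: "\<lbrakk>A \<in> Obj C; B \<in> Obj C; D \<in> Obj C; E \<in> Obj C\<rbrakk>
      \<Longrightarrow> Assoc C A B (D \<boxtimes> E) \<cdot> Assoc C (A \<boxtimes> B) D E =
          (Ident C A \<otimes> Assoc C B D E) \<cdot> Assoc C A (B \<boxtimes> D) E \<cdot> (Assoc C A B D \<otimes> Ident C E)"
    and triangle: "\<lbrakk>A \<in> Obj C; B \<in> Obj C\<rbrakk>
      \<Longrightarrow> (Ident C A \<otimes> LUnit C B) \<cdot> Assoc C A (Unit C) B = RUnit C A \<otimes> Ident C B"
    and hexagon: "\<lbrakk>A \<in> Obj C; B \<in> Obj C; D \<in> Obj C\<rbrakk>
      \<Longrightarrow> Assoc C B D A \<cdot> Symm C A (B \<boxtimes> D) \<cdot> Assoc C A B D =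
          (Ident C B \<otimes> Symm C A D) \<cdot> Assoc C B A D \<cdot> (Symm C A B \<otimes> Ident C D)"

definition adjoint :: "('o, 'a, 'm) sm_bicat_scheme \<Rightarrow> 'a \<Rightarrow> 'a \<Rightarrow> bool" where
  "adjoint C i j \<longleftrightarrow>
     i \<in> Arr C \<and> j \<in> hom C (Cod C i) (Dom C i) \<and>
     Ident C (Dom C i) \<sqsubseteq>\<^bsub>C\<^esub> j \<cdot>\<^bsub>C\<^esub> i \<and> i \<cdot>\<^bsub>C\<^esub> j \<sqsubseteq>\<^bsub>C\<^esub> Ident C (Cod C i)"

definition cocomm_comonoid :: "('o, 'a, 'm) sm_bicat_scheme \<Rightarrow> 'o \<Rightarrow> 'a \<Rightarrow> 'a \<Rightarrow> bool" where
  "cocomm_comonoid C A d e \<longleftrightarrow>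
     d \<in> hom C A (A \<boxtimes>\<^bsub>C\<^esub> A) \<and> e \<in> hom C A (Unit C) \<and>
     Assoc C A A A \<cdot>\<^bsub>C\<^esub> (d \<otimes>\<^bsub>C\<^esub> Ident C A) \<cdot>\<^bsub>C\<^esub> d = (Ident C A \<otimes>\<^bsub>C\<^esub> d) \<cdot>\<^bsub>C\<^esub> d \<and>
     LUnit C A \<cdot>\<^bsub>C\<^esub> (e \<otimes>\<^bsub>C\<^esub> Ident C A) \<cdot>\<^bsub>C\<^esub> d = Ident C A \<and>
     RUnit C A \<cdot>\<^bsub>C\<^esub> (Ident C A \<otimes>\<^bsub>C\<^esub> e) \<cdot>\<^bsub>C\<^esub> d = Ident C A \<and>
     Symm C A A \<cdot>\<^bsub>C\<^esub> d = d"


section \<open>Partial cartesian categories\<close>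

record ('o, 'a) pc_cat = "('o, 'a) sm_bicat" +
  Diag :: "'o \<Rightarrow> 'a"
  Bang :: "'o \<Rightarrow> 'a"
  Codiag :: "'o \<Rightarrow> 'a"

locale partial_cartesian_category =
  sm_posetal_bicategory C for C :: "('o, 'a, 'm) pc_cat_scheme" (structure) +
  assumes comonoid: "A \<in> Obj C \<Longrightarrow> cocomm_comonoid C A (Diag C A) (Bang C A)"
    and comonoid_unique: "\<lbrakk>A \<in> Obj C; cocomm_comonoid C A d e\<rbrakk> \<Longrightarrow> d = Diag C A \<and> e = Bang C A"
    and diag_natural: "f \<in> hom C A B \<Longrightarrow> Diag C B \<cdot> f = (f \<otimes> f) \<cdot> Diag C A"
    and bang_lax_natural: "f \<in> hom C A B \<Longrightarrow> Bang C B \<cdot> f \<sqsubseteq> Bang C A"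
    and diag_adjoint: "A \<in> Obj C \<Longrightarrow> adjoint C (Diag C A) (Codiag C A)"
    and frobenius: "A \<in> Obj C \<Longrightarrow>
      Diag C A \<cdot> Codiag C A =
      (Codiag C A \<otimes> Ident C A) \<cdot> inv_cell C (Assoc C A A A) \<cdot> (Ident C A \<otimes> Diag C A)"
    and meet_le: "\<lbrakk>f \<in> hom C A B; g \<in> hom C A B\<rbrakk> \<Longrightarrow> Codiag C B \<cdot> (f \<otimes> g) \<cdot> Diag C A \<sqsubseteq> f"

definition dom_idem :: "('o, 'a, 'm) pc_cat_scheme \<Rightarrow> 'a \<Rightarrow> 'a" where
  "dom_idem C f =
     RUnit C (Dom C f) \<cdot>\<^bsub>C\<^esub> (Ident C (Dom C f) \<otimes>\<^bsub>C\<^esub> (Bang C (Cod C f) \<cdot>\<^bsub>C\<^esub> f)) \<cdot>\<^bsub>C\<^esub> Diag C (Dom C f)"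

definition total_cell :: "('o, 'a, 'm) pc_cat_scheme \<Rightarrow> 'a \<Rightarrow> bool" where
  "total_cell C f \<longleftrightarrow> f \<in> Arr C \<and> dom_idem C f = Ident C (Dom C f)"

definition functionally_complete :: "('o, 'a, 'm) sm_bicat_scheme \<Rightarrow> bool" where
  "functionally_complete C \<longleftrightarrow>
     (\<forall>A \<in> Obj C. \<forall>d \<in> hom C A A. d \<sqsubseteq>\<^bsub>C\<^esub> Ident C A \<and> d \<cdot>\<^bsub>C\<^esub> d = d \<longrightarrow>
        (\<exists>B \<in> Obj C. \<exists>i \<in> hom C B A. \<exists>j \<in> hom C A B. adjoint C i j \<and> d = i \<cdot>\<^bsub>C\<^esub> j))"

text \<open>
  Chosen weak comma objects. For \<open>f : A \<rightarrow> B\<close> and \<open>g : D \<rightarrow> B\<close>, \<open>CommaL C f g : f/g \<rightarrow> A\<close> is the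
  projection \<open>g\<close>-hat and \<open>CommaR C f g : f/g \<rightarrow> D\<close> is the projection \<open>f\<close>-hat.
\<close>

record ('o, 'a) pc_cat_comma = "('o, 'a) pc_cat" +
  Comma :: "'a \<Rightarrow> 'a \<Rightarrow> 'o"
  CommaL :: "'a \<Rightarrow> 'a \<Rightarrow> 'a"
  CommaR :: "'a \<Rightarrow> 'a \<Rightarrow> 'a"

definition weak_comma_objects :: "('o, 'a, 'm) pc_cat_comma_scheme \<Rightarrow> bool" where
  "weak_comma_objects C \<longleftrightarrow>
     (\<forall>A B D f g. f \<in> hom C A B \<and> g \<in> hom C D B \<longrightarrow>
        Comma C f g \<in> Obj C \<and>
        CommaL C f g \<in> hom C (Comma C f g) A \<and> total_cell C (CommaL C f g) \<and>
        CommaR C f g \<in> hom C (Comma C f g) D \<and> total_cell C (CommaR C f g) \<and>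
        f \<cdot>\<^bsub>C\<^esub> CommaL C f g \<sqsubseteq>\<^bsub>C\<^esub> g \<cdot>\<^bsub>C\<^esub> CommaR C f g \<and>
        (\<forall>S \<phi> \<psi>. \<phi> \<in> hom C S A \<and> \<psi> \<in> hom C S D \<and> f \<cdot>\<^bsub>C\<^esub> \<phi> \<sqsubseteq>\<^bsub>C\<^esub> g \<cdot>\<^bsub>C\<^esub> \<psi> \<longrightarrow>
           (\<exists>!h. h \<in> hom C S (Comma C f g) \<and>
                 CommaL C f g \<cdot>\<^bsub>C\<^esub> h = \<phi> \<cdot>\<^bsub>C\<^esub> dom_idem C \<psi> \<and>
                 CommaR C f g \<cdot>\<^bsub>C\<^esub> h = \<psi> \<cdot>\<^bsub>C\<^esub> dom_idem C \<phi>)))"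


section \<open>Formulae and the sequent calculus\<close>

text \<open>\<open>Pull f Q\<close> is \<open>f\<^sup>* Q\<close> and \<open>Coprod f P\<close> is the coproduct of \<open>P\<close> along \<open>f\<close>.\<close>

datatype ('p, 'o, 'a) form =
    Atom 'p
  | Top 'o
  | Bot 'o
  | Neg "('p, 'o, 'a) form"
  | Conj "('p, 'o, 'a) form" "('p, 'o, 'a) form"
  | Disj "('p, 'o, 'a) form" "('p, 'o, 'a) form"
  | Pull 'a "('p, 'o, 'a) form"
  | Coprod 'a "('p, 'o, 'a) form"

text \<open>
  The parameter \<open>ty\<close> assigns types to atoms; an atom whose assigned type is not an object of the
  category is no formula, so that the set of atomic formulae may be arbitrary, even empty.
\<close>

inductive has_type ::
  "('o, 'a, 'm) pc_cat_comma_scheme \<Rightarrow> ('p \<Rightarrow> 'o) \<Rightarrow> ('p, 'o, 'a) form \<Rightarrow> 'o \<Rightarrow> bool"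
  for C :: "('o, 'a, 'm) pc_cat_comma_scheme" and ty :: "'p \<Rightarrow> 'o"
where
  Atom: "ty p \<in> Obj C \<Longrightarrow> has_type C ty (Atom p) (ty p)"
| Top: "A \<in> Obj C \<Longrightarrow> has_type C ty (Top A) A"
| Bot: "A \<in> Obj C \<Longrightarrow> has_type C ty (Bot A) A"
| Neg: "has_type C ty P A \<Longrightarrow> has_type C ty (Neg P) A"
| Conj: "\<lbrakk>has_type C ty P A; has_type C ty Q A\<rbrakk> \<Longrightarrow> has_type C ty (Conj P Q) A"
| Disj: "\<lbrakk>has_type C ty P A; has_type C ty Q A\<rbrakk> \<Longrightarrow> has_type C ty (Disj P Q) A"
| Pull: "\<lbrakk>f \<in> hom C A B; has_type C ty Q B\<rbrakk> \<Longrightarrow> has_type C ty (Pull f Q) A"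
| Coprod: "\<lbrakk>f \<in> hom C A B; has_type C ty P A\<rbrakk> \<Longrightarrow> has_type C ty (Coprod f P) B"

definition sequent ::
  "('o, 'a, 'm) pc_cat_comma_scheme \<Rightarrow> ('p \<Rightarrow> 'o) \<Rightarrow> 'o \<Rightarrow>
   ('p, 'o, 'a) form multiset \<Rightarrow> ('p, 'o, 'a) form multiset \<Rightarrow> bool" where
  "sequent C ty A \<Gamma> \<Delta> \<longleftrightarrow>
     A \<in> Obj C \<and> (\<forall>P \<in># \<Gamma>. has_type C ty P A) \<and> (\<forall>Q \<in># \<Delta>. has_type C ty Q A)"

definition pullL :: "'a \<Rightarrow> ('p, 'o, 'a) form multiset \<Rightarrow> ('p, 'o, 'a) form multiset" where
  "pullL f \<Gamma> = image_mset (Pull f) \<Gamma>"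

definition pullR ::
  "('o, 'a, 'm) sm_bicat_scheme \<Rightarrow> 'a \<Rightarrow> ('p, 'o, 'a) form multiset \<Rightarrow> ('p, 'o, 'a) form multiset" where
  "pullR C f \<Delta> = (if \<Delta> = {#} then {#Pull f (Bot (Cod C f))#} else image_mset (Pull f) \<Delta>)"

text \<open>
  Side conditions state the typing of the 1-cells and, in the axioms and in weakening, of the
  formulae; in all other rules the conclusion is well typed because the premises are. In
  \<open>PullBotL\<close> the formula on the left is \<open>\<bottom>\<close> itself; its variant with \<open>f\<^sup>* \<bottom>\<close> on the left is
  derivable by \<open>BotL\<close> followed by \<open>PullRule\<close>.
\<close>

inductive derivable ::
  "('o, 'a, 'm) pc_cat_comma_scheme \<Rightarrow> ('p \<Rightarrow> 'o) \<Rightarrow> 'o \<Rightarrow>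
   ('p, 'o, 'a) form multiset \<Rightarrow> ('p, 'o, 'a) form multiset \<Rightarrow> bool"
  for C :: "('o, 'a, 'm) pc_cat_comma_scheme" and ty :: "'p \<Rightarrow> 'o"
where
  Ax: "\<lbrakk>sequent C ty A \<Gamma> \<Delta>; has_type C ty P A\<rbrakk>
    \<Longrightarrow> derivable C ty A (add_mset P \<Gamma>) (add_mset P \<Delta>)"
| WeakL: "\<lbrakk>derivable C ty A \<Gamma> \<Delta>; has_type C ty P A\<rbrakk> \<Longrightarrow> derivable C ty A (add_mset P \<Gamma>) \<Delta>"
| WeakR: "\<lbrakk>derivable C ty A \<Gamma> \<Delta>; has_type C ty Q A\<rbrakk> \<Longrightarrow> derivable C ty A \<Gamma> (add_mset Q \<Delta>)"
| ContrL: "derivable C ty A (add_mset P (add_mset P \<Gamma>)) \<Delta> \<Longrightarrow> derivable C ty A (add_mset P \<Gamma>) \<Delta>"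
| ContrR: "derivable C ty A \<Gamma> (add_mset Q (add_mset Q \<Delta>)) \<Longrightarrow> derivable C ty A \<Gamma> (add_mset Q \<Delta>)"
| BotL: "sequent C ty A \<Gamma> \<Delta> \<Longrightarrow> derivable C ty A (add_mset (Bot A) \<Gamma>) \<Delta>"
| TopR: "sequent C ty A \<Gamma> \<Delta> \<Longrightarrow> derivable C ty A \<Gamma> (add_mset (Top A) \<Delta>)"
| PullBotL: "\<lbrakk>f \<in> hom C A B; sequent C ty B \<Gamma> \<Delta>\<rbrakk>
    \<Longrightarrow> derivable C ty A (add_mset (Bot A) (pullL f \<Gamma>)) (pullR C f \<Delta>)"
| PullTopR: "\<lbrakk>f \<in> hom C A B; sequent C ty A \<Gamma> \<Delta>\<rbrakk>
    \<Longrightarrow> derivable C ty A \<Gamma> (add_mset (Pull f (Top B)) \<Delta>)"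
| DisjL: "\<lbrakk>derivable C ty A (add_mset P1 \<Gamma>) \<Delta>; derivable C ty A (add_mset P2 \<Gamma>) \<Delta>\<rbrakk>
    \<Longrightarrow> derivable C ty A (add_mset (Disj P1 P2) \<Gamma>) \<Delta>"
| DisjR: "derivable C ty A \<Gamma> (add_mset Q1 (add_mset Q2 \<Delta>))
    \<Longrightarrow> derivable C ty A \<Gamma> (add_mset (Disj Q1 Q2) \<Delta>)"
| PullDisjL: "\<lbrakk>derivable C ty A (add_mset (Pull f P1) \<Gamma>) \<Delta>;
      derivable C ty A (add_mset (Pull f P2) \<Gamma>) \<Delta>\<rbrakk>
    \<Longrightarrow> derivable C ty A (add_mset (Pull f (Disj P1 P2)) \<Gamma>) \<Delta>"
| PullDisjR: "derivable C ty A \<Gamma> (add_mset (Pull f Q1) (add_mset (Pull f Q2) \<Delta>))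
    \<Longrightarrow> derivable C ty A \<Gamma> (add_mset (Pull f (Disj Q1 Q2)) \<Delta>)"
| ConjL: "derivable C ty A (add_mset P1 (add_mset P2 \<Gamma>)) \<Delta>
    \<Longrightarrow> derivable C ty A (add_mset (Conj P1 P2) \<Gamma>) \<Delta>"
| ConjR: "\<lbrakk>derivable C ty A \<Gamma> (add_mset Q1 \<Delta>); derivable C ty A \<Gamma> (add_mset Q2 \<Delta>)\<rbrakk>
    \<Longrightarrow> derivable C ty A \<Gamma> (add_mset (Conj Q1 Q2) \<Delta>)"
| PullConjL: "derivable C ty A (add_mset (Pull f P1) (add_mset (Pull f P2) \<Gamma>)) \<Delta>
    \<Longrightarrow> derivable C ty A (add_mset (Pull f (Conj P1 P2)) \<Gamma>) \<Delta>"
| PullConjR: "\<lbrakk>derivable C ty A \<Gamma> (add_mset (Pull f Q1) \<Delta>);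
      derivable C ty A \<Gamma> (add_mset (Pull f Q2) \<Delta>)\<rbrakk>
    \<Longrightarrow> derivable C ty A \<Gamma> (add_mset (Pull f (Conj Q1 Q2)) \<Delta>)"
| NegL: "derivable C ty A \<Gamma> (add_mset Q \<Delta>) \<Longrightarrow> derivable C ty A (add_mset (Neg Q) \<Gamma>) \<Delta>"
| NegR: "derivable C ty A (add_mset Q \<Gamma>) \<Delta> \<Longrightarrow> derivable C ty A \<Gamma> (add_mset (Neg Q) \<Delta>)"
| PullNegL: "\<lbrakk>derivable C ty A (add_mset (Pull f (Bot (Cod C f))) \<Gamma>) \<Delta>;
      derivable C ty A \<Gamma> (add_mset (Pull f Q) \<Delta>)\<rbrakk>
    \<Longrightarrow> derivable C ty A (add_mset (Pull f (Neg Q)) \<Gamma>) \<Delta>"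
| PullNegR: "derivable C ty A (add_mset (Pull f Q) \<Gamma>) (add_mset (Pull f (Bot (Cod C f))) \<Delta>)
    \<Longrightarrow> derivable C ty A \<Gamma> (add_mset (Pull f (Neg Q)) \<Delta>)"
| Cut: "\<lbrakk>f1 \<in> hom C A B; f2 \<in> hom C A B; f2 \<sqsubseteq>\<^bsub>C\<^esub> f1;
      derivable C ty A \<Gamma> (add_mset (Pull f1 P) \<Delta>);
      derivable C ty A (add_mset (Pull f2 P) \<Gamma>') \<Delta>'\<rbrakk>
    \<Longrightarrow> derivable C ty A (\<Gamma> + \<Gamma>') (\<Delta> + \<Delta>')"
| PullRule: "\<lbrakk>f \<in> hom C A B; derivable C ty B \<Gamma> \<Delta>\<rbrakk>
    \<Longrightarrow> derivable C ty A (pullL f \<Gamma>) (pullR C f \<Delta>)"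
| CoprodL: "\<lbrakk>f \<in> hom C A B; g \<in> hom C D B;
      derivable C ty (Comma C f g)
        (add_mset (Pull (CommaR C f g) P) (pullL (CommaL C f g) \<Gamma>))
        (pullR C (CommaL C f g) \<Delta>)\<rbrakk>
    \<Longrightarrow> derivable C ty A (add_mset (Pull f (Coprod g P)) \<Gamma>) \<Delta>"
| CoprodR: "\<lbrakk>f \<in> hom C A B; g \<in> hom C D B; \<tau> \<in> hom C A D; f \<sqsubseteq>\<^bsub>C\<^esub> g \<cdot>\<^bsub>C\<^esub> \<tau>;
      derivable C ty A \<Gamma> (add_mset (Pull \<tau> Q) \<Delta>)\<rbrakk>
    \<Longrightarrow> derivable C ty A \<Gamma> (add_mset (Pull f (Coprod g Q)) \<Delta>)"
| LeL: "\<lbrakk>f \<in> hom C A B; g \<in> hom C A B; f \<sqsubseteq>\<^bsub>C\<^esub> g; derivable C ty A (add_mset (Pull f P) \<Gamma>) \<Delta>\<rbrakk>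
    \<Longrightarrow> derivable C ty A (add_mset (Pull g P) \<Gamma>) \<Delta>"
| LeR: "\<lbrakk>f \<in> hom C A B; g \<in> hom C A B; f \<sqsubseteq>\<^bsub>C\<^esub> g; derivable C ty A \<Gamma> (add_mset (Pull g Q) \<Delta>)\<rbrakk>
    \<Longrightarrow> derivable C ty A \<Gamma> (add_mset (Pull f Q) \<Delta>)"
| LeLR: "\<lbrakk>f \<in> hom C A B; g \<in> hom C A B; f \<sqsubseteq>\<^bsub>C\<^esub> g;
      derivable C ty A (\<Gamma> + pullL g \<Gamma>') (pullR C g \<Delta>' + \<Delta>)\<rbrakk>
    \<Longrightarrow> derivable C ty A (\<Gamma> + pullL f \<Gamma>') (pullR C f \<Delta>' + \<Delta>)"
| CompL: "\<lbrakk>f \<in> hom C A B; g \<in> hom C B D; derivable C ty A (add_mset (Pull f (Pull g P)) \<Gamma>) \<Delta>\<rbrakk>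
    \<Longrightarrow> derivable C ty A (add_mset (Pull (g \<cdot>\<^bsub>C\<^esub> f) P) \<Gamma>) \<Delta>"
| CompR: "\<lbrakk>f \<in> hom C A B; g \<in> hom C B D; derivable C ty A \<Gamma> (add_mset (Pull f (Pull g Q)) \<Delta>)\<rbrakk>
    \<Longrightarrow> derivable C ty A \<Gamma> (add_mset (Pull (g \<cdot>\<^bsub>C\<^esub> f) Q) \<Delta>)"
| CompInvL: "\<lbrakk>f \<in> hom C A B; g \<in> hom C B D; derivable C ty A (add_mset (Pull (g \<cdot>\<^bsub>C\<^esub> f) P) \<Gamma>) \<Delta>\<rbrakk>
    \<Longrightarrow> derivable C ty A (add_mset (Pull f (Pull g P)) \<Gamma>) \<Delta>"
| CompInvR: "\<lbrakk>f \<in> hom C A B; g \<in> hom C B D; derivable C ty A \<Gamma> (add_mset (Pull (g \<cdot>\<^bsub>C\<^esub> f) Q) \<Delta>)\<rbrakk>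
    \<Longrightarrow> derivable C ty A \<Gamma> (add_mset (Pull f (Pull g Q)) \<Delta>)"
| IdL: "derivable C ty A (add_mset P \<Gamma>) \<Delta> \<Longrightarrow> derivable C ty A (add_mset (Pull (Ident C A) P) \<Gamma>) \<Delta>"
| IdR: "derivable C ty A \<Gamma> (add_mset Q \<Delta>) \<Longrightarrow> derivable C ty A \<Gamma> (add_mset (Pull (Ident C A) Q) \<Delta>)"
| IdInvL: "derivable C ty A (add_mset (Pull (Ident C A) P) \<Gamma>) \<Delta> \<Longrightarrow> derivable C ty A (add_mset P \<Gamma>) \<Delta>"
| IdInvR: "derivable C ty A \<Gamma> (add_mset (Pull (Ident C A) Q) \<Delta>) \<Longrightarrow> derivable C ty A \<Gamma> (add_mset Q \<Delta>)"

text \<open>The formula \<open>x = y\<close> in the context \<open>x : A, y : A, z : B\<close>, that is, of type \<open>(A \<boxtimes> A) \<boxtimes> B\<close>.\<close>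

definition eq_form :: "('o, 'a, 'm) pc_cat_scheme \<Rightarrow> 'o \<Rightarrow> 'o \<Rightarrow> ('p, 'o, 'a) form" where
  "eq_form C A B = Neg (Pull (Codiag C A \<otimes>\<^bsub>C\<^esub> Ident C B) (Bot (A \<boxtimes>\<^bsub>C\<^esub> B)))"

end

theory Submission
  imports Defs
begin

text \<open>
  Since \<open>\<nabla>\<close> is right adjoint and left inverse to \<open>\<Delta>\<close>, the cells \<open>d = \<Delta> \<otimes> id\<close> and
  \<open>n = \<nabla> \<otimes> id\<close> satisfy \<open>n \<cdot> d = id\<close> and \<open>d \<cdot> n \<sqsubseteq> id\<close>. A formula
  \<open>f\<^sup>* Q\<close> reads ``if \<open>f\<close> is defined, then \<open>Q\<close> holds of its value'', so \<open>\<not> n\<^sup>* \<bottom>\<close> says that \<open>n\<close> is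
  defined. Downwards, pull back along \<open>d\<close> and cut against \<open>\<turnstile> d\<^sup>* \<not> n\<^sup>* \<bottom>\<close>. Upwards, pull back
  along \<open>n\<close>: on the left \<open>P\<close> implies \<open>n\<^sup>* d\<^sup>* P\<close>, and on the right \<open>n\<^sup>* d\<^sup>* Q \<turnstile> Q, n\<^sup>* \<bottom>\<close>.
\<close>

text \<open>\<open>Cut\<close> only removes formulae of the form \<open>f\<^sup>* P\<close>, so
  \<open>P\<close> is first presented on both sides as its pullback along the identity.\<close>

lemma cut_formula:
  assumes "posetal_bicategory C" "A \<in> Obj C"
    and "derivable C ty A \<Gamma> (add_mset P \<Delta>)"
    and "derivable C ty A (add_mset P \<Gamma>') \<Delta>'"
  shows "derivable C ty A (\<Gamma> + \<Gamma>') (\<Delta> + \<Delta>')"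
proof -
  have h: "Ident C A \<in> hom C A A"
    using assms(1,2) by (rule posetal_bicategory.id_hom)
  show ?thesis
    using derivable.Cut[OF h h posetal_bicategory.le_refl[OF assms(1) h]
        derivable.IdR[OF assms(3)] derivable.IdL[OF assms(4)]] .
qed

lemma contract_right_copies:
  assumes "derivable C ty A \<Gamma> (add_mset Q (replicate_mset k Q + \<Delta>))"
  shows "derivable C ty A \<Gamma> (add_mset Q \<Delta>)"
  using assms by (induction k) (auto intro: derivable.ContrR)

text \<open>An adjunction with left adjoint \<open>d\<close>, right adjoint \<open>n\<close> and an
  equality as unit. The two-way rule is proved for any such pair, so tensors enter only at the final
  instantiation.\<close>

locale coreflection_cells = posetal_bicategory C
  for C :: "('o, 'a, 'm) pc_cat_comma_scheme" (structure) +
  fixes X Y :: 'o and d n :: 'a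
  assumes d_hom: "d \<in> hom C X Y" and n_hom: "n \<in> hom C Y X"
    and n_comp_d: "n \<cdot> d = Ident C X" and d_comp_n: "d \<cdot> n \<sqsubseteq> Ident C Y"
begin

lemma X_obj: "X \<in> Obj C" and Y_obj: "Y \<in> Obj C"
  using d_hom dom_obj cod_obj by (auto simp: hom_def)

lemma Cod_d: "Cod C d = Y"
  using d_hom by (simp add: hom_def)

lemma dn_hom: "d \<cdot> n \<in> hom C Y Y"
  using comp_hom[OF n_hom d_hom] .

lemma idY_hom: "Ident C Y \<in> hom C Y Y"
  using id_hom[OF Y_obj] .

lemma type_n_Bot: "has_type C ty (Pull n (Bot X)) Y"
  using n_hom X_obj by (auto intro: has_type.intros)

lemma type_d_Bot: "has_type C ty (Pull d (Bot Y)) X"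
  using d_hom Y_obj by (auto intro: has_type.intros)

text \<open>By \<open>PullNegR\<close> it suffices to derive \<open>d\<^sup>* \<bottom>\<close> from
  \<open>d\<^sup>* n\<^sup>* \<bottom>\<close>; the latter amounts to \<open>\<bottom>\<close>,
  because \<open>n \<cdot> d\<close> is the identity.\<close>

lemma derivable_pull_defined:
  "derivable C ty X {#} {#Pull d (Neg (Pull n (Bot X)))#}"
proof -
  have "derivable C ty X {#Bot X#} {#Pull d (Bot Y)#}"
    by (rule derivable.BotL) (simp add: sequent_def X_obj type_d_Bot)
  then have "derivable C ty X {#Pull (n \<cdot> d) (Bot X)#} {#Pull d (Bot Y)#}"
    unfolding n_comp_d by (rule derivable.IdL)
  then have "derivable C ty X {#Pull d (Pull n (Bot X))#} {#Pull d (Bot Y)#}"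
    by (rule derivable.CompInvL[OF d_hom n_hom])
  then show ?thesis
    using derivable.PullNegR[of C ty X d "Pull n (Bot X)" "{#}" "{#}"] by (simp add: Cod_d)
qed

text \<open>The cell \<open>d\<close> is total because it has the left inverse \<open>n\<close>.\<close>

lemma derivable_pull_Bot:
  "derivable C ty X {#Pull d (Bot Y)#} {#Bot X#}"
proof -
  have "derivable C ty Y {#Bot Y#} {#Pull n (Bot X)#}"
    by (rule derivable.BotL) (simp add: sequent_def Y_obj type_n_Bot)
  from derivable.PullRule[OF d_hom this]
  have "derivable C ty X {#Pull d (Bot Y)#} {#Pull d (Pull n (Bot X))#}"
    by (simp add: pullL_def pullR_def)
  from derivable.CompR[OF d_hom n_hom this]
  show ?thesis
    unfolding n_comp_d by (rule derivable.IdInvR)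
qed

text \<open>Where \<open>n\<close> is undefined, \<open>n\<^sup>* d\<^sup>* Q\<close> holds
  vacuously and says nothing about \<open>Q\<close>; the alternative
  \<open>n\<^sup>* \<bottom>\<close> on the right accounts for this case.\<close>

lemma derivable_pull_pull_elim:
  assumes Q: "has_type C ty Q Y"
  shows "derivable C ty Y {#Pull n (Pull d Q)#} {#Pull n (Bot X), Q#}"
proof -
  \<comment> \<open>\<open>LeLR\<close> applied with the empty right-hand side, whose pullback is \<open>\<bottom>\<close> pulled back: this
      trades \<open>id\<^sup>* Q \<turnstile> id\<^sup>* \<bottom>, Q\<close> for \<open>(d \<cdot> n)\<^sup>* Q \<turnstile> (d \<cdot> n)\<^sup>* \<bottom>, Q\<close>.\<close>
  have "derivable C ty Y {#Q#} {#Q, Pull (Ident C Y) (Bot Y)#}"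
    by (rule derivable.Ax)
       (simp_all add: sequent_def Y_obj Q has_type.Pull[OF idY_hom] has_type.Bot)
  then have "derivable C ty Y {#Pull (Ident C Y) Q#} {#Q, Pull (Ident C Y) (Bot Y)#}"
    by (rule derivable.IdL)
  then have "derivable C ty Y ({#} + pullL (Ident C Y) {#Q#}) (pullR C (Ident C Y) {#} + {#Q#})"
    using idY_hom by (simp add: pullL_def pullR_def hom_def add_mset_commute)
  from derivable.LeLR[OF dn_hom idY_hom d_comp_n this]
  have "derivable C ty Y {#Pull (d \<cdot> n) Q#} {#Pull (d \<cdot> n) (Bot Y), Q#}"
    using dn_hom by (simp add: pullL_def pullR_def hom_def add_mset_commute)
  then have 1: "derivable C ty Y {#Pull n (Pull d Q)#} {#Pull n (Pull d (Bot Y)), Q#}"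
    by (rule derivable.CompInvL[OF n_hom d_hom, OF derivable.CompInvR[OF n_hom d_hom]])
  \<comment> \<open>Totality of \<open>d\<close> turns the alternative
    \<open>n\<^sup>* d\<^sup>* \<bottom>\<close> of the first sequent into
    \<open>n\<^sup>* \<bottom>\<close>.\<close>
  have 2: "derivable C ty Y {#Pull n (Pull d (Bot Y))#} {#Pull n (Bot X)#}"
    using derivable.PullRule[OF n_hom derivable_pull_Bot] by (simp add: pullL_def pullR_def)
  show ?thesis
    using cut_formula[OF posetal_bicategory_axioms Y_obj 1 2] by (simp add: add_mset_commute)
qed

text \<open>Since \<open>d \<cdot> n\<close> lies below the identity, \<open>LeL\<close> lets each
  \<open>P\<close> replace its weaker form \<open>(d \<cdot> n)\<^sup>* P\<close>. The multiset
  \<open>\<Theta>\<close> collects the formulae already treated.\<close>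

lemma derivable_left_unpull:
  assumes "derivable C ty Y (\<Theta> + pullL n (pullL d \<Gamma>)) \<Delta>"
  shows "derivable C ty Y (\<Theta> + \<Gamma>) \<Delta>"
  using assms
proof (induction \<Gamma> arbitrary: \<Theta>)
  case empty
  then show ?case by (simp add: pullL_def)
next
  case (add P \<Gamma>)
  then have "derivable C ty Y (add_mset (Pull n (Pull d P)) (\<Theta> + pullL n (pullL d \<Gamma>))) \<Delta>"
    by (simp add: pullL_def)
  then have "derivable C ty Y (add_mset (Pull (d \<cdot> n) P) (\<Theta> + pullL n (pullL d \<Gamma>))) \<Delta>"
    by (rule derivable.CompL[OF n_hom d_hom])
  then have "derivable C ty Y (add_mset (Pull (Ident C Y) P) (\<Theta> + pullL n (pullL d \<Gamma>))) \<Delta>"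
    by (rule derivable.LeL[OF dn_hom idY_hom d_comp_n])
  then have "derivable C ty Y (add_mset P \<Theta> + pullL n (pullL d \<Gamma>)) \<Delta>"
    by (simp add: derivable.IdInvL)
  from add.IH[OF this] show ?case by simp
qed

text \<open>Each formula is restored by one cut, which leaves behind one copy of
  \<open>n\<^sup>* \<bottom>\<close>. The plain image \<open>pullL\<close> is used on the right so
  that the induction can start from the empty multiset.\<close>

lemma derivable_right_unpull:
  assumes "derivable C ty Y \<Gamma> (\<Theta> + pullL n (pullL d \<Delta>))" "\<forall>Q \<in># \<Delta>. has_type C ty Q Y"
  shows "derivable C ty Y \<Gamma> (replicate_mset (size \<Delta>) (Pull n (Bot X)) + \<Theta> + \<Delta>)"
  using assms
proof (induction \<Delta> arbitrary: \<Theta>)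
  case empty
  then show ?case by (simp add: pullL_def)
next
  case (add Q \<Delta>)
  then have "derivable C ty Y \<Gamma> (add_mset (Pull n (Pull d Q)) (\<Theta> + pullL n (pullL d \<Delta>)))"
    by (simp add: pullL_def)
  from cut_formula[OF posetal_bicategory_axioms Y_obj this derivable_pull_pull_elim] add.prems(2)
  have "derivable C ty Y \<Gamma> (add_mset (Pull n (Bot X)) (add_mset Q \<Theta>) + pullL n (pullL d \<Delta>))"
    by simp
  from add.IH[OF this] add.prems(2) show ?case by (simp add: add_mset_commute)
qed

theorem derivable_defined_iff:
  assumes \<Gamma>': "\<forall>Q \<in># \<Gamma>'. has_type C ty Q Y"
  shows "derivable C ty Y (add_mset (Neg (Pull n (Bot X))) \<Gamma>) \<Gamma>' \<longleftrightarrow>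
         derivable C ty X (pullL d \<Gamma>) (pullR C d \<Gamma>')"
proof
  assume "derivable C ty Y (add_mset (Neg (Pull n (Bot X))) \<Gamma>) \<Gamma>'"
  from derivable.PullRule[OF d_hom this]
  have "derivable C ty X (add_mset (Pull d (Neg (Pull n (Bot X)))) (pullL d \<Gamma>)) (pullR C d \<Gamma>')"
    by (simp add: pullL_def)
  from cut_formula[OF posetal_bicategory_axioms X_obj derivable_pull_defined this]
  show "derivable C ty X (pullL d \<Gamma>) (pullR C d \<Gamma>')" by simp
next
  assume D: "derivable C ty X (pullL d \<Gamma>) (pullR C d \<Gamma>')"
  \<comment> \<open>An empty right-hand side has the same pullback as the singleton of
    \<open>\<bottom>\<close>; with \<open>\<Delta>\<close> both pullbacks are plain images.\<close>
  define \<Delta> where "\<Delta> = (if \<Gamma>' = {#} then {#Bot Y#} else \<Gamma>')"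
  have \<Delta>: "\<forall>Q \<in># \<Delta>. has_type C ty Q Y"
    using \<Gamma>' Y_obj by (auto simp: \<Delta>_def intro: has_type.intros)
  have "pullR C n (pullR C d \<Gamma>') = pullL n (pullL d \<Delta>)"
    by (simp add: pullR_def pullL_def \<Delta>_def Cod_d)
  with derivable.PullRule[OF n_hom D]
  have "derivable C ty Y ({#} + pullL n (pullL d \<Gamma>)) ({#} + pullL n (pullL d \<Delta>))"
    by simp
  from derivable_right_unpull[OF derivable_left_unpull[OF this] \<Delta>]
  have "derivable C ty Y \<Gamma> (replicate_mset (size \<Delta>) (Pull n (Bot X)) + \<Delta>)"
    by simp
  \<comment> \<open>The added copy of \<open>n\<^sup>* \<bottom>\<close> is the one that contraction
    keeps.\<close>
  from derivable.WeakR[OF this type_n_Bot]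
  have *: "derivable C ty Y \<Gamma> (add_mset (Pull n (Bot X)) \<Delta>)"
    by (rule contract_right_copies)
  have "derivable C ty Y \<Gamma> (add_mset (Pull n (Bot X)) \<Gamma>')"
  proof (cases "\<Gamma>' = {#}")
    case True
    \<comment> \<open>The \<open>\<bottom>\<close> standing in for the empty right-hand side is cut
      away again.\<close>
    have "derivable C ty Y {#Bot Y#} {#}"
      by (rule derivable.BotL) (simp add: sequent_def Y_obj)
    moreover have "derivable C ty Y \<Gamma> (add_mset (Bot Y) {#Pull n (Bot X)#})"
      using * True by (simp add: \<Delta>_def add_mset_commute)
    ultimately show ?thesis
      using cut_formula[OF posetal_bicategory_axioms Y_obj] True by fastforce
  next
    case False
    then show ?thesis using * by (simp add: \<Delta>_def)
  qed
  then show "derivable C ty Y (add_mset (Neg (Pull n (Bot X))) \<Gamma>) \<Gamma>'"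
    by (rule derivable.NegL)
qed

end

context partial_cartesian_category
begin

lemma diag_hom: "A \<in> Obj C \<Longrightarrow> Diag C A \<in> hom C A (A \<boxtimes> A)"
  using comonoid by (simp add: cocomm_comonoid_def)

lemma codiag_hom: "A \<in> Obj C \<Longrightarrow> Codiag C A \<in> hom C (A \<boxtimes> A) A"
  using diag_adjoint diag_hom by (simp add: adjoint_def hom_def)

lemma diag_codiag_le: "A \<in> Obj C \<Longrightarrow> Diag C A \<cdot> Codiag C A \<sqsubseteq> Ident C (A \<boxtimes> A)"
  using diag_adjoint diag_hom by (simp add: adjoint_def hom_def)

text \<open>One inequality is the unit of the adjunction; the other is \<open>meet_le\<close> for
  two identities, whose meet is \<open>\<nabla> \<cdot> \<Delta>\<close>.\<close>

lemma codiag_diag: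
  assumes A: "A \<in> Obj C"
  shows "Codiag C A \<cdot> Diag C A = Ident C A"
proof (rule le_antisym)
  show "Codiag C A \<cdot> Diag C A \<in> hom C A A"
    using comp_hom[OF diag_hom codiag_hom] A by blast
  show "Ident C A \<sqsubseteq> Codiag C A \<cdot> Diag C A"
    using diag_adjoint[OF A] diag_hom[OF A] by (simp add: adjoint_def hom_def)
  show "Codiag C A \<cdot> Diag C A \<sqsubseteq> Ident C A"
    using meet_le[OF id_hom id_hom, OF A A] id_right[OF codiag_hom[OF A]]
    by (simp add: tensor_id A)
qed (rule id_hom[OF A])

end

theorem proposition22:
  fixes C :: "('o, 'a) pc_cat_comma"
    and ty :: "'p \<Rightarrow> 'o"
    and A B :: 'o
    and \<Gamma> \<Gamma>' :: "('p, 'o, 'a) form multiset"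
  assumes "partial_cartesian_category C"
    and "functionally_complete C"
    and "weak_comma_objects C"
    and "A \<in> Obj C"
    and "B \<in> Obj C"
    and "\<forall>P \<in># \<Gamma>. has_type C ty P ((A \<boxtimes>\<^bsub>C\<^esub> A) \<boxtimes>\<^bsub>C\<^esub> B)"
    and "\<forall>P \<in># \<Gamma>'. has_type C ty P ((A \<boxtimes>\<^bsub>C\<^esub> A) \<boxtimes>\<^bsub>C\<^esub> B)"
  shows "derivable C ty ((A \<boxtimes>\<^bsub>C\<^esub> A) \<boxtimes>\<^bsub>C\<^esub> B) (add_mset (eq_form C A B) \<Gamma>) \<Gamma>' \<longleftrightarrow>
         derivable C ty (A \<boxtimes>\<^bsub>C\<^esub> B)
           (pullL (Diag C A \<otimes>\<^bsub>C\<^esub> Ident C B) \<Gamma>)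
           (pullR C (Diag C A \<otimes>\<^bsub>C\<^esub> Ident C B) \<Gamma>')"
proof -
  interpret partial_cartesian_category C by fact
  note A = \<open>A \<in> Obj C\<close> and B = \<open>B \<in> Obj C\<close>
  note idB = id_hom[OF B]
  note idB_idB = id_left[OF idB]
  \<comment> \<open>Tensoring with the identity of \<open>B\<close> is functorial and monotone, so
    it preserves both defining relations of the pair.\<close>
  interpret coreflection_cells C "A \<boxtimes>\<^bsub>C\<^esub> B" "(A \<boxtimes>\<^bsub>C\<^esub> A) \<boxtimes>\<^bsub>C\<^esub> B"
    "Diag C A \<otimes>\<^bsub>C\<^esub> Ident C B" "Codiag C A \<otimes>\<^bsub>C\<^esub> Ident C B"
  proof
    show "Diag C A \<otimes>\<^bsub>C\<^esub> Ident C B \<in> hom C (A \<boxtimes>\<^bsub>C\<^esub> B) ((A \<boxtimes>\<^bsub>C\<^esub> A) \<boxtimes>\<^bsub>C\<^esub> B)"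
      using tensor_hom[OF diag_hom[OF A] idB] .
    show "Codiag C A \<otimes>\<^bsub>C\<^esub> Ident C B \<in> hom C ((A \<boxtimes>\<^bsub>C\<^esub> A) \<boxtimes>\<^bsub>C\<^esub> B) (A \<boxtimes>\<^bsub>C\<^esub> B)"
      using tensor_hom[OF codiag_hom[OF A] idB] .
    show "(Codiag C A \<otimes>\<^bsub>C\<^esub> Ident C B) \<cdot>\<^bsub>C\<^esub> (Diag C A \<otimes>\<^bsub>C\<^esub> Ident C B) = Ident C (A \<boxtimes>\<^bsub>C\<^esub> B)"
      using tensor_comp[OF diag_hom[OF A] codiag_hom[OF A] idB idB]
      by (simp add: idB_idB codiag_diag A B tensor_id)
    have "(Diag C A \<cdot>\<^bsub>C\<^esub> Codiag C A) \<otimes>\<^bsub>C\<^esub> Ident C B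
        \<sqsubseteq>\<^bsub>C\<^esub> Ident C (A \<boxtimes>\<^bsub>C\<^esub> A) \<otimes>\<^bsub>C\<^esub> Ident C B"
      using tensor_mono[OF comp_hom[OF codiag_hom[OF A] diag_hom[OF A]]
          id_hom[OF tensor_obj[OF A A]] idB idB diag_codiag_le[OF A] le_refl[OF idB]] .
    then show "(Diag C A \<otimes>\<^bsub>C\<^esub> Ident C B) \<cdot>\<^bsub>C\<^esub> (Codiag C A \<otimes>\<^bsub>C\<^esub> Ident C B)
        \<sqsubseteq>\<^bsub>C\<^esub> Ident C ((A \<boxtimes>\<^bsub>C\<^esub> A) \<boxtimes>\<^bsub>C\<^esub> B)"
      using tensor_comp[OF codiag_hom[OF A] diag_hom[OF A] idB idB]
      by (simp add: idB_idB tensor_id tensor_obj A B)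
  qed
  show ?thesis
    unfolding eq_form_def by (rule derivable_defined_iff) fact
qed

end
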